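(* Consider the panel change point model $Y_{i,t}=\mu_i+\delta_i\mathcal{I}\{t>\tau\}+\sigma\varepsilon_{i,t}$, $1\le i\le N$, $1\le t\le T$, with $T$ fixed and error vectors satisfying the conditions in the context. Suppose that $\tau\le T-3$, that the alternative $H_1$ holds (i.e. $\tau<T$ and there exists $i\in\{1,\ldots,N\}$ with $\delta_i\neq0$), and that $$\lim_{N\to\infty}\frac{1}{\sqrt{N}}\left|\sum_{i=1}^N\delta_i\right|=\infty.$$ Then $\mathcal{R}_N(T)\to\infty$ in probability $\mathsf{P}$ as $N\to\infty$.
   Context: Panel change point model: $Y_{i,t}=\mu_i+\delta_i\mathcal{I}\{t>\tau\}+\sigma\varepsilon_{i,t}$, $1\le i\le N$, $1\le t\le T$, where $\sigma>0$ is an unknown parameter, $\mu_i,\delta_i$ are (non-random) real numbers (the $\delta_i$ may depend on $N$), $\tau\in\{1,\ldots,T\}$ is the common change point, and $T$ is fixed (not depending on $N$). Conditions on the errors: the vectors $[\varepsilon_{i,1},\ldots,\varepsilon_{i,T}]^{\top}$, defined on a probability space $(\Omega,\mathcal{F},\mathsf{P})$, are iid for $i=1,\ldots,N$, with $\mathsf{E}\varepsilon_{i,t}=0$, $\mathsf{Var}\,\varepsilon_{i,t}=1$, and autocorrelation function $\rho_t=\mathsf{Corr}(\varepsilon_{i,s},\varepsilon_{i,s+t})=\mathsf{Cov}(\varepsilon_{i,s},\varepsilon_{i,s+t})$ for all $s\in\{1,\ldots,T-t\}$, not depending on $s$. Test statistic: $$\mathcal{R}_N(T)=\max_{t=2,\ldots,T-2}\frac{\max_{s=1,\ldots,t}\left|\sum_{i=1}^N\left[\sum_{r=1}^s\left(Y_{i,r}-\overline{Y}_{i,t}\right)\right]\right|}{\max_{s=t,\ldots,T-1}\left|\sum_{i=1}^N\left[\sum_{r=s+1}^T\left(Y_{i,r}-\widetilde{Y}_{i,t}\right)\right]\right|},$$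 with $\overline{Y}_{i,t}=\frac1t\sum_{s=1}^tY_{i,s}$ and $\widetilde{Y}_{i,t}=\frac{1}{T-t}\sum_{s=t+1}^TY_{i,s}$. *)

theory Defs
  imports "HOL-Probability.Probability"
begin

definition covariance :: "'a measure \<Rightarrow> ('a \<Rightarrow> real) \<Rightarrow> ('a \<Rightarrow> real) \<Rightarrow> real" where
  "covariance P X Z =
     (\<integral>\<omega>. (X \<omega> - (\<integral>\<omega>'. X \<omega>' \<partial>P)) * (Z \<omega> - (\<integral>\<omega>'. Z \<omega>' \<partial>P)) \<partial>P)"

definition correlation :: "'a measure \<Rightarrow> ('a \<Rightarrow> real) \<Rightarrow> ('a \<Rightarrow> real) \<Rightarrow> real" where
  "correlation P X Z =
     covariance P X Z / (sqrt (covariance P X X) * sqrt (covariance P Z Z))"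

text \<open>Panels \<open>i\<close> and time points \<open>t\<close> are numbered from 1.  The error vector of panel \<open>i\<close>
  is an element of the product space over \<open>{1..T}\<close>; values of \<open>\<epsilon> i t\<close> at other indices are
  irrelevant.\<close>

definition error_vector :: "nat \<Rightarrow> (nat \<Rightarrow> nat \<Rightarrow> 'a \<Rightarrow> real) \<Rightarrow> nat \<Rightarrow> 'a \<Rightarrow> nat \<Rightarrow> real" where
  "error_vector T \<epsilon> i \<omega> = (\<lambda>t\<in>{1..T}. \<epsilon> i t \<omega>)"

locale panel_errors = prob_space P for P :: "'a measure" +
  fixes T :: nat and \<rho> :: "nat \<Rightarrow> real" and \<epsilon> :: "nat \<Rightarrow> nat \<Rightarrow> 'a \<Rightarrow> real"
  assumes independent:
      "indep_vars (\<lambda>_. \<Pi>\<^sub>M t\<in>{1..T}. borel) (error_vector T \<epsilon>) {1..}"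
    and identically_distributed:
      "\<And>i j. 1 \<le> i \<Longrightarrow> 1 \<le> j \<Longrightarrow>
         distr P (\<Pi>\<^sub>M t\<in>{1..T}. borel) (error_vector T \<epsilon> i) =
         distr P (\<Pi>\<^sub>M t\<in>{1..T}. borel) (error_vector T \<epsilon> j)"
    and square_integrable:
      "\<And>i t. 1 \<le> i \<Longrightarrow> t \<in> {1..T} \<Longrightarrow> integrable P (\<lambda>\<omega>. (\<epsilon> i t \<omega>)\<^sup>2)"
    and mean_zero: "\<And>i t. 1 \<le> i \<Longrightarrow> t \<in> {1..T} \<Longrightarrow> expectation (\<epsilon> i t) = 0"
    and unit_variance: "\<And>i t. 1 \<le> i \<Longrightarrow> t \<in> {1..T} \<Longrightarrow> variance (\<epsilon> i t) = 1"
    and autocorrelation: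
      "\<And>i s h. 1 \<le> i \<Longrightarrow> s \<in> {1..T - h} \<Longrightarrow> \<rho> h = correlation P (\<epsilon> i s) (\<epsilon> i (s + h))"

lemma (in panel_errors) autocovariance:
  assumes "1 \<le> i" "s \<in> {1..T - h}"
  shows "\<rho> h = covariance P (\<epsilon> i s) (\<epsilon> i (s + h))"
proof -
  have "s \<in> {1..T}" "s + h \<in> {1..T}" using assms by auto
  then have "covariance P (\<epsilon> i s) (\<epsilon> i s) = 1"
    and "covariance P (\<epsilon> i (s + h)) (\<epsilon> i (s + h)) = 1"
    using unit_variance assms(1) by (simp_all add: covariance_def power2_eq_square)
  then show ?thesis
    using autocorrelation[OF assms] by (simp add: correlation_def)
qed

definition panel_obs ::
  "(nat \<Rightarrow> real) \<Rightarrow> (nat \<Rightarrow> real) \<Rightarrow> nat \<Rightarrow> real \<Rightarrow> (nat \<Rightarrow> nat \<Rightarrow> 'a \<Rightarrow> real)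
     \<Rightarrow> 'a \<Rightarrow> nat \<Rightarrow> nat \<Rightarrow> real" where
  "panel_obs \<mu> \<delta> \<tau> \<sigma> \<epsilon> \<omega> i t = \<mu> i + \<delta> i * of_bool (t > \<tau>) + \<sigma> * \<epsilon> i t \<omega>"

definition alternative_H1 :: "nat \<Rightarrow> nat \<Rightarrow> nat \<Rightarrow> (nat \<Rightarrow> real) \<Rightarrow> bool" where
  "alternative_H1 N T \<tau> \<delta> \<longleftrightarrow> \<tau> < T \<and> (\<exists>i\<in>{1..N}. \<delta> i \<noteq> 0)"

definition mean_before :: "(nat \<Rightarrow> nat \<Rightarrow> real) \<Rightarrow> nat \<Rightarrow> nat \<Rightarrow> real" where
  "mean_before y i t = (1 / real t) * (\<Sum>s=1..t. y i s)"

definition mean_after :: "nat \<Rightarrow> (nat \<Rightarrow> nat \<Rightarrow> real) \<Rightarrow> nat \<Rightarrow> nat \<Rightarrow> real" where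
  "mean_after T y i t = (1 / real (T - t)) * (\<Sum>s=t+1..T. y i s)"

definition ratio_numerator :: "nat \<Rightarrow> (nat \<Rightarrow> nat \<Rightarrow> real) \<Rightarrow> nat \<Rightarrow> real" where
  "ratio_numerator N y t =
     (MAX s\<in>{1..t}. \<bar>\<Sum>i=1..N. \<Sum>r=1..s. (y i r - mean_before y i t)\<bar>)"

definition ratio_denominator :: "nat \<Rightarrow> nat \<Rightarrow> (nat \<Rightarrow> nat \<Rightarrow> real) \<Rightarrow> nat \<Rightarrow> real" where
  "ratio_denominator N T y t =
     (MAX s\<in>{t..T-1}. \<bar>\<Sum>i=1..N. \<Sum>r=s+1..T. (y i r - mean_after T y i t)\<bar>)"

text \<open>The error conditions do not prevent the denominator from vanishing, even almost surely
  (take \<open>\<rho> h = 1\<close> for all \<open>h\<close>).  The statistic is therefore valued in \<^typ>\<open>ereal\<close>, where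
  \<open>c / 0 = \<infinity>\<close> for \<open>c > 0\<close>; the convention \<open>0 / 0 = 0\<close> assigns the undefined
  ratio the least possible value.\<close>

definition ratio_statistic :: "nat \<Rightarrow> nat \<Rightarrow> (nat \<Rightarrow> nat \<Rightarrow> real) \<Rightarrow> ereal" where
  "ratio_statistic N T y =
     (MAX t\<in>{2..T-2}. ereal (ratio_numerator N y t) / ereal (ratio_denominator N T y t))"

definition diverges_in_probability :: "'a measure \<Rightarrow> (nat \<Rightarrow> 'a \<Rightarrow> ereal) \<Rightarrow> bool" where
  "diverges_in_probability P X \<longleftrightarrow>
     (\<forall>K::real. (\<lambda>n. measure P {\<omega> \<in> space P. X n \<omega> > ereal K}) \<longlonglongrightarrow> 1)"

end

theory Submission
  imports Defs
begin

text \<open>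
  The reason for the divergence is visible at the single split point \<open>t = \<tau> + 1\<close>, which lies in
  the range \<open>{2..T - 2}\<close> of the maximum because \<open>1 \<le> \<tau> \<le> T - 3\<close>.  The panels enter the statistic
  only through the cross-sectional sums of the observations at each time.  Let \<open>D\<close> be the sum of
  all the jumps \<open>\<delta>\<close>, and let \<open>S r\<close> be the sum over the panels of the errors at time \<open>r\<close>.

  At \<open>t = \<tau> + 1\<close> every observation used by the denominator comes after the change, so the jumps
  cancel against the mean and only errors remain.  The window \<open>{1..\<tau> + 1}\<close> of the numerator
  contains exactly one observation after the change, so centring at its mean leaves, at \<open>s = \<tau>\<close>,
  the drift \<open>-\<tau> D / (\<tau> + 1)\<close> plus errors.  If all \<open>\<bar>S r\<bar>\<close> are at most \<open>B\<close>, the ratio at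
  \<open>t = \<tau> + 1\<close> therefore exceeds any given \<open>K\<close> as soon as \<open>\<bar>D\<bar>\<close> exceeds a fixed multiple
  of \<open>B\<close> (\<open>ratio_statistic_gt_if_errors_bounded\<close>).

  The errors of distinct panels are independent and centred, hence orthogonal, so \<open>S r\<close> has
  second moment \<open>N\<close>, and Markov's inequality for \<open>\<Sum>r. (S r)\<^sup>2\<close> gives \<open>\<bar>S r\<bar> \<le> sqrt (c N)\<close>
  for all \<open>r\<close> at once with probability at least \<open>1 - T / c\<close> (\<open>prob_error_sums_bounded\<close>).  Since
  \<open>\<bar>D\<bar>\<close> grows faster than \<open>sqrt N\<close>, the required multiple is eventually exceeded for every \<open>c\<close>.
\<close>

section \<open>Deviations from partial means\<close>

text \<open>Averaging is linear, so summing over the panels commutes with centring; this reduces the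
  statistic to that of the cross-sectional sums.\<close>

lemma sum_deviation_before:
  "(\<Sum>i=1..N. \<Sum>r=1..s. (y i r - mean_before y i t)) =
     (\<Sum>r=1..s. \<Sum>i=1..N. y i r) - real s / real t * (\<Sum>r=1..t. \<Sum>i=1..N. y i r)"
proof -
  have "(\<Sum>i=1..N. \<Sum>r=1..s. (y i r - mean_before y i t)) =
      (\<Sum>i=1..N. \<Sum>r=1..s. y i r) - real s / real t * (\<Sum>i=1..N. \<Sum>r=1..t. y i r)"
    by (simp add: sum_subtractf mean_before_def sum_distrib_left)
  then show ?thesis
    by (simp only: sum.swap[where g = y and A = "{1..N}"])
qed

lemma sum_deviation_after:
  assumes "s \<le> T"
  shows "(\<Sum>i=1..N. \<Sum>r=s+1..T. (y i r - mean_after T y i t)) =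
     (\<Sum>r=s+1..T. \<Sum>i=1..N. y i r)
       - real (T - s) / real (T - t) * (\<Sum>r=t+1..T. \<Sum>i=1..N. y i r)"
proof -
  have "(\<Sum>i=1..N. \<Sum>r=s+1..T. (y i r - mean_after T y i t)) =
      (\<Sum>i=1..N. \<Sum>r=s+1..T. y i r)
        - real (T - s) / real (T - t) * (\<Sum>i=1..N. \<Sum>r=t+1..T. y i r)"
    using assms by (simp add: sum_subtractf mean_after_def sum_distrib_left)
  then show ?thesis
    by (simp only: sum.swap[where g = y and A = "{1..N}"])
qed

lemma abs_sum_le_card_mult:
  fixes f :: "'i \<Rightarrow> real"
  assumes "\<And>r. r \<in> A \<Longrightarrow> \<bar>f r\<bar> \<le> B"
  shows "\<bar>\<Sum>r\<in>A. f r\<bar> \<le> real (card A) * B"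
proof -
  have "\<bar>\<Sum>r\<in>A. f r\<bar> \<le> (\<Sum>r\<in>A. \<bar>f r\<bar>)" by (rule sum_abs)
  also have "\<dots> \<le> real (card A) * B" using assms by (rule sum_bounded_above)
  finally show ?thesis .
qed

lemma sum_panel_obs:
  "(\<Sum>i=1..N. panel_obs \<mu> \<delta> \<tau> \<sigma> \<epsilon> \<omega> i r) =
     (\<Sum>i=1..N. \<mu> i) + (\<Sum>i=1..N. \<delta> i) * of_bool (r > \<tau>) + \<sigma> * (\<Sum>i=1..N. \<epsilon> i r \<omega>)"
  by (simp add: panel_obs_def sum.distrib sum_distrib_left)

section \<open>The ratio just after the change\<close>

text \<open>At \<open>s = \<tau>\<close> the individual levels \<open>\<mu>\<close> cancel, while the only jump in the window, the one at
  time \<open>\<tau> + 1\<close>, is seen through the mean alone and hence with weight \<open>\<tau> / (\<tau> + 1)\<close>.\<close>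

lemma ratio_numerator_after_change_ge:
  fixes \<sigma> B :: real
  assumes "\<sigma> \<ge> 0" "1 \<le> \<tau>"
    and bound: "\<And>r. r \<in> {1..\<tau> + 1} \<Longrightarrow> \<bar>\<Sum>i=1..N. \<epsilon> i r \<omega>\<bar> \<le> B"
  shows "real \<tau> / real (\<tau> + 1) * (\<bar>\<Sum>i=1..N. \<delta> i\<bar> - 2 * \<sigma> * B)
           \<le> ratio_numerator N (panel_obs \<mu> \<delta> \<tau> \<sigma> \<epsilon> \<omega>) (\<tau> + 1)"
proof -
  define S where "S r = (\<Sum>i=1..N. \<epsilon> i r \<omega>)" for r
  define D where "D = (\<Sum>i=1..N. \<delta> i)"
  define m where "m = (\<Sum>i=1..N. \<mu> i)"
  define p where "p = (\<Sum>r=1..\<tau>. S r)"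
  define q where "q = real \<tau> / real (\<tau> + 1)"
  let ?y = "panel_obs \<mu> \<delta> \<tau> \<sigma> \<epsilon> \<omega>"
  let ?v = "\<Sum>i=1..N. \<Sum>r=1..\<tau>. (?y i r - mean_before ?y i (\<tau> + 1))"
  have "(\<Sum>r=1..\<tau>. \<Sum>i=1..N. ?y i r) = (\<Sum>r=1..\<tau>. m + \<sigma> * S r)"
    unfolding sum_panel_obs by (intro sum.cong) (auto simp: m_def S_def)
  then have before: "(\<Sum>r=1..\<tau>. \<Sum>i=1..N. ?y i r) = real \<tau> * m + \<sigma> * p"
    by (simp add: sum.distrib sum_distrib_left p_def)
  have at_change: "(\<Sum>i=1..N. ?y i (\<tau> + 1)) = m + D + \<sigma> * S (\<tau> + 1)"
    by (simp only: sum_panel_obs) (simp add: m_def D_def S_def)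
  have "?v = real \<tau> * m + \<sigma> * p
      - q * (real \<tau> * m + \<sigma> * p + (m + D + \<sigma> * S (\<tau> + 1)))"
    unfolding sum_deviation_before using before at_change by (simp add: q_def)
  also have "\<dots> = q * (\<sigma> * (p / real \<tau> - S (\<tau> + 1)) - D)"
    using assms(2) by (simp add: q_def divide_simps) algebra
  finally have v: "?v = q * (\<sigma> * (p / real \<tau> - S (\<tau> + 1)) - D)" .
  have "\<bar>p\<bar> \<le> real \<tau> * B"
    unfolding p_def using abs_sum_le_card_mult[of "{1..\<tau>}" S B] bound by (simp add: S_def)
  then have "\<bar>p / real \<tau>\<bar> \<le> B"
    using assms(2) by (simp add: divide_le_eq mult.commute)
  moreover have "\<bar>S (\<tau> + 1)\<bar> \<le> B"
    using bound[of "\<tau> + 1"] by (simp add: S_def)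
  ultimately have "\<bar>p / real \<tau> - S (\<tau> + 1)\<bar> \<le> 2 * B" by linarith
  then have "\<bar>\<sigma> * (p / real \<tau> - S (\<tau> + 1))\<bar> \<le> \<sigma> * (2 * B)"
    unfolding abs_mult using assms(1) by (simp add: mult_left_mono)
  then have "\<bar>D\<bar> - 2 * \<sigma> * B \<le> \<bar>\<sigma> * (p / real \<tau> - S (\<tau> + 1)) - D\<bar>" by linarith
  moreover have q: "0 \<le> q" by (simp add: q_def)
  ultimately have "q * (\<bar>D\<bar> - 2 * \<sigma> * B) \<le> q * \<bar>\<sigma> * (p / real \<tau> - S (\<tau> + 1)) - D\<bar>"
    by (rule mult_left_mono)
  also have "\<dots> = \<bar>?v\<bar>" unfolding v abs_mult using q by simp
  also have "\<dots> \<le> ratio_numerator N ?y (\<tau> + 1)"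
    unfolding ratio_numerator_def using assms(2) by (intro Max_ge) auto
  finally show ?thesis by (simp add: q_def D_def)
qed

text \<open>After the change all observations of panel \<open>i\<close> share the level \<open>\<mu> i + \<delta> i\<close>, which centring removes.\<close>

lemma ratio_denominator_after_change_le:
  fixes \<sigma> B :: real
  assumes "\<sigma> \<ge> 0" "\<tau> \<le> t" "t < T"
    and bound: "\<And>r. r \<in> {t + 1..T} \<Longrightarrow> \<bar>\<Sum>i=1..N. \<epsilon> i r \<omega>\<bar> \<le> B"
  shows "ratio_denominator N T (panel_obs \<mu> \<delta> \<tau> \<sigma> \<epsilon> \<omega>) t \<le> 2 * \<sigma> * real T * B"
proof -
  define S where "S r = (\<Sum>i=1..N. \<epsilon> i r \<omega>)" for r
  define L where "L = (\<Sum>i=1..N. \<mu> i) + (\<Sum>i=1..N. \<delta> i)"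
  let ?y = "panel_obs \<mu> \<delta> \<tau> \<sigma> \<epsilon> \<omega>"
  have B: "0 \<le> B" using bound[of T] assms(3) by fastforce
  have tail: "(\<Sum>r=s+1..T. \<Sum>i=1..N. ?y i r) = real (T - s) * L + \<sigma> * (\<Sum>r=s+1..T. S r)"
    if "t \<le> s" for s
  proof -
    have "(\<Sum>r=s+1..T. \<Sum>i=1..N. ?y i r) = (\<Sum>r=s+1..T. L + \<sigma> * S r)"
      unfolding sum_panel_obs using that assms(2) by (intro sum.cong) (auto simp: L_def S_def)
    then show ?thesis by (simp add: sum.distrib sum_distrib_left)
  qed
  have tail_errors: "\<bar>\<Sum>r=s+1..T. S r\<bar> \<le> real (T - s) * B" if "t \<le> s" for s
    using abs_sum_le_card_mult[of "{s+1..T}" S B] bound that by (simp add: S_def)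
  have "\<bar>\<Sum>i=1..N. \<Sum>r=s+1..T. (?y i r - mean_after T ?y i t)\<bar> \<le> 2 * \<sigma> * real T * B"
    if s: "s \<in> {t..T-1}" for s
  proof -
    define a where "a = (\<Sum>r=s+1..T. S r)"
    define b where "b = (\<Sum>r=t+1..T. S r)"
    define c where "c = real (T - s) / real (T - t)"
    have st: "s \<le> T" "t \<le> s" using s by auto
    have c: "0 \<le> c" "c * real (T - t) = real (T - s)" using assms(3) by (auto simp: c_def)
    have "(\<Sum>i=1..N. \<Sum>r=s+1..T. (?y i r - mean_after T ?y i t)) =
        real (T - s) * L + \<sigma> * a - c * (real (T - t) * L + \<sigma> * b)"
      by (simp only: sum_deviation_after[OF st(1)] tail[OF st(2)] tail[OF order_refl]
          a_def b_def c_def)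
    also have "\<dots> = \<sigma> * (a - c * b)"
      unfolding c(2)[symmetric] by (simp add: algebra_simps)
    finally have dev: "(\<Sum>i=1..N. \<Sum>r=s+1..T. (?y i r - mean_after T ?y i t)) =
        \<sigma> * (a - c * b)" .
    have ab: "\<bar>a\<bar> \<le> real (T - s) * B" "\<bar>b\<bar> \<le> real (T - t) * B"
      using tail_errors s by (auto simp: a_def b_def)
    from ab(2) have "\<bar>c * b\<bar> \<le> c * (real (T - t) * B)"
      unfolding abs_mult using c(1) by (simp add: mult_left_mono)
    also have "\<dots> = real (T - s) * B" by (simp only: c(2) flip: mult.assoc)
    finally have "\<bar>a - c * b\<bar> \<le> 2 * (real (T - s) * B)" using ab(1) by arith
    also have "\<dots> \<le> 2 * (real T * B)" using B by (simp add: mult_right_mono)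
    finally have "\<bar>a - c * b\<bar> \<le> 2 * (real T * B)" .
    then have "\<sigma> * \<bar>a - c * b\<bar> \<le> \<sigma> * (2 * (real T * B))" by (rule mult_left_mono) fact
    then show ?thesis unfolding dev using assms(1) by (simp add: abs_mult mult_ac)
  qed
  then show ?thesis
    unfolding ratio_denominator_def using assms(3) by (intro Max.boundedI) auto
qed

lemma ratio_denominator_nonneg:
  assumes "t < T"
  shows "0 \<le> ratio_denominator N T y t"
proof -
  have "0 \<le> \<bar>\<Sum>i=1..N. \<Sum>r=t+1..T. (y i r - mean_after T y i t)\<bar>" by simp
  also have "\<dots> \<le> ratio_denominator N T y t"
    unfolding ratio_denominator_def using assms by (intro Max_ge) auto
  finally show ?thesis .
qed

text \<open>The factor \<open>1 / 2\<close> lost here is the least possible weight \<open>\<tau> / (\<tau> + 1)\<close> of the jump.  A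
  vanishing denominator does no harm, because the numerator is then still positive.\<close>

lemma ratio_statistic_gt_if_errors_bounded:
  fixes \<sigma> B K :: real
  assumes "\<sigma> \<ge> 0" "1 \<le> \<tau>" "\<tau> + 3 \<le> T" "0 \<le> K"
    and bound: "\<And>r. r \<in> {1..T} \<Longrightarrow> \<bar>\<Sum>i=1..N. \<epsilon> i r \<omega>\<bar> \<le> B"
    and jump: "2 * \<sigma> * (1 + 2 * K * real T) * B < \<bar>\<Sum>i=1..N. \<delta> i\<bar>"
  shows "ereal K < ratio_statistic N T (panel_obs \<mu> \<delta> \<tau> \<sigma> \<epsilon> \<omega>)"
proof -
  let ?y = "panel_obs \<mu> \<delta> \<tau> \<sigma> \<epsilon> \<omega>"
  define n where "n = ratio_numerator N ?y (\<tau> + 1)"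
  define d where "d = ratio_denominator N T ?y (\<tau> + 1)"
  define D where "D = \<bar>\<Sum>i=1..N. \<delta> i\<bar>"
  have B: "0 \<le> B" using bound[of T] assms(3) by fastforce
  define e where "e = K * (2 * \<sigma> * real T * B)"
  have "2 * \<sigma> * B + 2 * e < D"
    using jump by (simp add: D_def e_def algebra_simps)
  moreover have "0 \<le> e" unfolding e_def using assms(1,4) B by simp
  ultimately have gap: "2 * e < D - 2 * \<sigma> * B" and pos: "0 \<le> D - 2 * \<sigma> * B"
    by simp_all
  have d: "0 \<le> d" "d \<le> 2 * \<sigma> * real T * B"
    unfolding d_def using assms by (auto intro!: ratio_denominator_nonneg
      ratio_denominator_after_change_le bound)
  have "1 / 2 \<le> real \<tau> / real (\<tau> + 1)" using assms(2) by (simp add: field_simps)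
  then have "1 / 2 * (D - 2 * \<sigma> * B) \<le> real \<tau> / real (\<tau> + 1) * (D - 2 * \<sigma> * B)"
    by (rule mult_right_mono) fact
  also have "\<dots> \<le> n"
    unfolding n_def D_def using assms by (intro ratio_numerator_after_change_ge bound) auto
  finally have "D - 2 * \<sigma> * B \<le> 2 * n" by simp
  with gap have "e < n" by simp
  moreover have "K * d \<le> e"
    unfolding e_def using d(2) assms(4) by (rule mult_left_mono)
  ultimately have Kd: "K * d < n" by linarith
  moreover have "0 \<le> K * d" using d(1) assms(4) by simp
  ultimately have n: "0 < n" by linarith
  have "ereal K < ereal n / ereal d"
  proof (cases "d = 0")
    case False
    then show ?thesis using d(1) Kd by (simp add: less_divide_eq)
  qed (use n in simp)
  also have "\<dots> \<le> ratio_statistic N T ?y"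
    unfolding ratio_statistic_def n_def d_def using assms(2,3)
    by (intro Max_ge finite_imageI finite_atLeastAtMost imageI) auto
  finally show ?thesis .
qed

section \<open>Size of the error sums\<close>

text \<open>Independence makes centred variables orthogonal, so in the expansion of the square of
  their sum only the diagonal terms survive.\<close>

lemma (in prob_space) second_moment_sum_indep_vars:
  fixes X :: "'i \<Rightarrow> 'a \<Rightarrow> real"
  assumes fin: "finite I" and indep: "indep_vars (\<lambda>_. borel) X I"
    and square: "\<And>i. i \<in> I \<Longrightarrow> integrable M (\<lambda>\<omega>. (X i \<omega>)\<^sup>2)"
    and centred: "\<And>i. i \<in> I \<Longrightarrow> expectation (X i) = 0"
  shows integrable_square_sum_indep_vars: "integrable M (\<lambda>\<omega>. (\<Sum>i\<in>I. X i \<omega>)\<^sup>2)"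
    and expectation_square_sum_indep_vars:
      "expectation (\<lambda>\<omega>. (\<Sum>i\<in>I. X i \<omega>)\<^sup>2) = (\<Sum>i\<in>I. expectation (\<lambda>\<omega>. (X i \<omega>)\<^sup>2))"
proof -
  have rv: "random_variable borel (X i)" if "i \<in> I" for i
    using indep that by (simp add: indep_vars_def)
  have int: "integrable M (X i)" if "i \<in> I" for i
    using square_integrable_imp_integrable[OF rv[OF that] square[OF that]] .
  have off_diagonal: "integrable M (\<lambda>\<omega>. X i \<omega> * X j \<omega>)" "expectation (\<lambda>\<omega>. X i \<omega> * X j \<omega>) = 0"
    if "i \<in> I" "j \<in> I" "i \<noteq> j" for i j
  proof -
    have "indep_vars (\<lambda>_. borel) X {i, j}" using indep that by (auto intro: indep_vars_subset)
    then show "integrable M (\<lambda>\<omega>. X i \<omega> * X j \<omega>)" "expectation (\<lambda>\<omega>. X i \<omega> * X j \<omega>) = 0"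
      using indep_vars_integrable[of "{i, j}" X] indep_vars_lebesgue_integral[of "{i, j}" X]
        int centred that by auto
  qed
  have products: "integrable M (\<lambda>\<omega>. X i \<omega> * X j \<omega>)" if "i \<in> I" "j \<in> I" for i j
    using off_diagonal(1) square that by (cases "i = j") (auto simp: power2_eq_square)
  have expand: "(\<Sum>i\<in>I. X i \<omega>)\<^sup>2 = (\<Sum>i\<in>I. \<Sum>j\<in>I. X i \<omega> * X j \<omega>)" for \<omega>
    by (simp add: power2_eq_square sum_product)
  show "integrable M (\<lambda>\<omega>. (\<Sum>i\<in>I. X i \<omega>)\<^sup>2)"
    unfolding expand using products by (intro Bochner_Integration.integrable_sum)
  have "expectation (\<lambda>\<omega>. (\<Sum>i\<in>I. X i \<omega>)\<^sup>2) = (\<Sum>i\<in>I. \<Sum>j\<in>I. expectation (\<lambda>\<omega>. X i \<omega> * X j \<omega>))"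
    unfolding expand using products by (simp add: Bochner_Integration.integral_sum)
  also have "\<dots> = (\<Sum>i\<in>I. \<Sum>j\<in>I. if j = i then expectation (\<lambda>\<omega>. (X i \<omega>)\<^sup>2) else 0)"
    using off_diagonal(2) by (intro sum.cong) (auto simp: power2_eq_square)
  also have "\<dots> = (\<Sum>i\<in>I. expectation (\<lambda>\<omega>. (X i \<omega>)\<^sup>2))"
    using fin by simp
  finally show "expectation (\<lambda>\<omega>. (\<Sum>i\<in>I. X i \<omega>)\<^sup>2) = (\<Sum>i\<in>I. expectation (\<lambda>\<omega>. (X i \<omega>)\<^sup>2))" .
qed

context panel_errors
begin

lemma indep_vars_errors_at_time:
  assumes "r \<in> {1..T}"
  shows "indep_vars (\<lambda>_. borel) (\<lambda>i. \<epsilon> i r) {1..}"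
proof -
  have "indep_vars (\<lambda>_. borel) (\<lambda>i \<omega>. error_vector T \<epsilon> i \<omega> r) {1..}"
    using assms
    by (intro indep_vars_compose2[OF independent, where Y = "\<lambda>_ v. v r"]
      measurable_component_singleton)
  then show ?thesis using assms by (simp add: error_vector_def)
qed

lemma random_variable_error:
  "1 \<le> i \<Longrightarrow> r \<in> {1..T} \<Longrightarrow> random_variable borel (\<epsilon> i r)"
  using indep_vars_errors_at_time[of r] by (simp add: indep_vars_def)

lemma second_moment_error_sum:
  assumes r: "r \<in> {1..T}"
  shows integrable_square_error_sum: "integrable P (\<lambda>\<omega>. (\<Sum>i=1..N. \<epsilon> i r \<omega>)\<^sup>2)"
    and expectation_square_error_sum: "expectation (\<lambda>\<omega>. (\<Sum>i=1..N. \<epsilon> i r \<omega>)\<^sup>2) = real N"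
proof -
  have indep: "indep_vars (\<lambda>_. borel) (\<lambda>i. \<epsilon> i r) {1..N}"
    using indep_vars_errors_at_time[OF r] by (rule indep_vars_subset) auto
  have unit: "expectation (\<lambda>\<omega>. (\<epsilon> i r \<omega>)\<^sup>2) = 1" if "i \<in> {1..N}" for i
    using unit_variance[of i r] mean_zero[of i r] r that by simp
  show "integrable P (\<lambda>\<omega>. (\<Sum>i=1..N. \<epsilon> i r \<omega>)\<^sup>2)"
    using r by (intro integrable_square_sum_indep_vars[OF _ indep] square_integrable mean_zero) auto
  have "expectation (\<lambda>\<omega>. (\<Sum>i=1..N. \<epsilon> i r \<omega>)\<^sup>2) = (\<Sum>i=1..N. expectation (\<lambda>\<omega>. (\<epsilon> i r \<omega>)\<^sup>2))"
    using r by (intro expectation_square_sum_indep_vars[OF _ indep] square_integrable mean_zero) auto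
  then show "expectation (\<lambda>\<omega>. (\<Sum>i=1..N. \<epsilon> i r \<omega>)\<^sup>2) = real N"
    using unit by simp
qed

text \<open>Every \<open>(S r)\<^sup>2\<close> is at most the sum of these squares over the time points, which has expectation
  \<open>T N\<close>; a single use of Markov's inequality for that sum bounds all time points simultaneously.\<close>

lemma prob_error_sums_bounded:
  assumes "0 < c" "0 < N"
  shows "1 - real T / c
    \<le> prob {\<omega> \<in> space P. \<forall>r\<in>{1..T}. \<bar>\<Sum>i=1..N. \<epsilon> i r \<omega>\<bar> \<le> sqrt (c * real N)}"
proof -
  define Q where "Q \<omega> = (\<Sum>r=1..T. (\<Sum>i=1..N. \<epsilon> i r \<omega>)\<^sup>2)" for \<omega>
  have int_Q: "integrable P Q"
    unfolding Q_def by (intro Bochner_Integration.integrable_sum integrable_square_error_sum)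
  have "expectation Q = (\<Sum>r=1..T. expectation (\<lambda>\<omega>. (\<Sum>i=1..N. \<epsilon> i r \<omega>)\<^sup>2))"
    unfolding Q_def by (intro Bochner_Integration.integral_sum integrable_square_error_sum)
  also have "\<dots> = (\<Sum>r=1..T. real N)"
    by (intro sum.cong refl expectation_square_error_sum)
  finally have exp_Q: "expectation Q = real T * real N" by simp
  have meas_Q [measurable]: "random_variable borel Q" using int_Q by simp
  have meas_sum [measurable]: "random_variable borel (\<lambda>\<omega>. \<Sum>i=1..N. \<epsilon> i r \<omega>)" if "r \<in> {1..T}" for r
    using that by (intro borel_measurable_sum random_variable_error) auto
  have "prob {\<omega> \<in> space P. c * real N \<le> Q \<omega>} \<le> expectation Q / (c * real N)"
    using assms
    by (intro integral_Markov_inequality_measure[OF int_Q sets.empty_sets])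
       (auto simp: Q_def sum_nonneg)
  also have "\<dots> = real T / c" using assms(2) by (simp add: exp_Q)
  finally have "1 - real T / c \<le> 1 - prob {\<omega> \<in> space P. c * real N \<le> Q \<omega>}" by simp
  also have "\<dots> = prob (space P - {\<omega> \<in> space P. c * real N \<le> Q \<omega>})"
    by (rule prob_compl[symmetric]) measurable
  also have "\<dots> \<le> prob {\<omega> \<in> space P. \<forall>r\<in>{1..T}. \<bar>\<Sum>i=1..N. \<epsilon> i r \<omega>\<bar> \<le> sqrt (c * real N)}"
  proof (rule finite_measure_mono)
    show "{\<omega> \<in> space P. \<forall>r\<in>{1..T}. \<bar>\<Sum>i=1..N. \<epsilon> i r \<omega>\<bar> \<le> sqrt (c * real N)} \<in> events"
      by (rule sets.sets_Collect_finite_All) (use meas_sum in \<open>auto intro!: borel_measurable_le\<close>)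
    have "\<bar>\<Sum>i=1..N. \<epsilon> i r \<omega>\<bar> \<le> sqrt (c * real N)"
      if "Q \<omega> < c * real N" "r \<in> {1..T}" for \<omega> r
    proof (rule real_le_rsqrt)
      have "(\<Sum>i=1..N. \<epsilon> i r \<omega>)\<^sup>2 \<le> Q \<omega>"
        unfolding Q_def using that(2) by (intro member_le_sum) auto
      then show "\<bar>\<Sum>i=1..N. \<epsilon> i r \<omega>\<bar>\<^sup>2 \<le> c * real N" using that(1) by simp
    qed
    then show "space P - {\<omega> \<in> space P. c * real N \<le> Q \<omega>} \<subseteq>
        {\<omega> \<in> space P. \<forall>r\<in>{1..T}. \<bar>\<Sum>i=1..N. \<epsilon> i r \<omega>\<bar> \<le> sqrt (c * real N)}"
      by (auto simp: not_le)
  qed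
  finally show ?thesis .
qed

text \<open>The value of \<^const>\<open>measure\<close> on a set that is not an event is zero, so bounding the
  probability that the statistic is large from below requires that it be a random variable.\<close>

lemma random_variable_ratio_statistic:
  "random_variable borel (\<lambda>\<omega>. ratio_statistic N T (panel_obs \<mu> \<delta> \<tau> \<sigma> \<epsilon> \<omega>))"
proof -
  have obs: "random_variable borel (\<lambda>\<omega>. panel_obs \<mu> \<delta> \<tau> \<sigma> \<epsilon> \<omega> i r)"
    if "1 \<le> i" "r \<in> {1..T}" for i r
    unfolding panel_obs_def using random_variable_error[OF that] by measurable
  show ?thesis
    unfolding ratio_statistic_def ratio_numerator_def ratio_denominator_def
      mean_before_def mean_after_def
    by (intro borel_measurable_Max borel_measurable_ereal_divide borel_measurable_ereal
        borel_measurable_abs borel_measurable_sum borel_measurable_diff borel_measurable_times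
        borel_measurable_const obs finite_atLeastAtMost) auto
qed

end

section \<open>Divergence of the statistic\<close>

theorem theorem2:
  fixes P :: "'a measure"
    and T \<tau> :: nat
    and \<sigma> :: real
    and \<mu> \<rho> :: "nat \<Rightarrow> real"
    and \<delta> :: "nat \<Rightarrow> nat \<Rightarrow> real"
    and \<epsilon> :: "nat \<Rightarrow> nat \<Rightarrow> 'a \<Rightarrow> real"
  assumes errors: "panel_errors P T \<rho> \<epsilon>"
    and sigma_pos: "\<sigma> > 0"
    and change_point: "\<tau> \<in> {1..T}"
    and tau_bound: "\<tau> + 3 \<le> T"
    and H1: "\<forall>\<^sub>F N in sequentially. alternative_H1 N T \<tau> (\<delta> N)"
    and divergence:
      "filterlim (\<lambda>N. (1 / sqrt (real N)) * \<bar>\<Sum>i=1..N. \<delta> N i\<bar>) at_top sequentially"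
  shows "diverges_in_probability P
    (\<lambda>N \<omega>. ratio_statistic N T (panel_obs \<mu> (\<delta> N) \<tau> \<sigma> \<epsilon> \<omega>))"
proof -
  interpret panel_errors P T \<rho> \<epsilon> by (rule errors)
  let ?R = "\<lambda>N \<omega>. ratio_statistic N T (panel_obs \<mu> (\<delta> N) \<tau> \<sigma> \<epsilon> \<omega>)"
  show ?thesis
    unfolding diverges_in_probability_def
  proof (intro allI order_tendstoI)
    fix K a :: real
    assume "1 < a"
    then show "\<forall>\<^sub>F N in sequentially. prob {\<omega> \<in> space P. ?R N \<omega> > ereal K} < a"
      by (intro always_eventually allI) (meson le_less_trans prob_le_1)
  next
    fix K a :: real
    assume "a < 1"
    \<comment> \<open>The choice of \<open>c\<close> makes the exceptional probability \<open>T / c\<close> equal to \<open>(1 - a) / 2\<close>.\<close>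
    define c where "c = 2 * real T / (1 - a)"
    define k where "k = max K 0"
    have c: "0 < c" "real T / c = (1 - a) / 2"
      using \<open>a < 1\<close> tau_bound by (auto simp: c_def)
    have exceptional: "a < 1 - real T / c"
      unfolding c(2) using \<open>a < 1\<close> by (simp add: field_simps)
    have "\<forall>\<^sub>F N in sequentially.
        2 * \<sigma> * (1 + 2 * k * real T) * sqrt c < (1 / sqrt (real N)) * \<bar>\<Sum>i=1..N. \<delta> N i\<bar>"
      using divergence by (auto simp: filterlim_at_top_dense)
    then show "\<forall>\<^sub>F N in sequentially. a < prob {\<omega> \<in> space P. ?R N \<omega> > ereal K}"
      using eventually_gt_at_top[of 0]
    proof eventually_elim
      case (elim N)
      let ?E = "{\<omega> \<in> space P. \<forall>r\<in>{1..T}. \<bar>\<Sum>i=1..N. \<epsilon> i r \<omega>\<bar> \<le> sqrt (c * real N)}"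
      have jump: "2 * \<sigma> * (1 + 2 * k * real T) * sqrt (c * real N) < \<bar>\<Sum>i=1..N. \<delta> N i\<bar>"
        using elim by (simp add: less_divide_eq real_sqrt_mult mult.assoc)
      have "a < prob ?E"
        using c(1) exceptional prob_error_sums_bounded[of c N] elim(2) by linarith
      also have "\<dots> \<le> prob {\<omega> \<in> space P. ?R N \<omega> > ereal K}"
      proof (rule finite_measure_mono)
        show "{\<omega> \<in> space P. ?R N \<omega> > ereal K} \<in> events"
          using random_variable_ratio_statistic by measurable
        have "ereal K < ?R N \<omega>" if "\<omega> \<in> ?E" for \<omega>
        proof -
          have "ereal K \<le> ereal k" by (simp add: k_def)
          also have "ereal k < ?R N \<omega>"
            using that sigma_pos change_point tau_bound jump
            by (intro ratio_statistic_gt_if_errors_bounded[where B = "sqrt (c * real N)"])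
               (auto simp: k_def)
          finally show ?thesis .
        qed
        then show "?E \<subseteq> {\<omega> \<in> space P. ?R N \<omega> > ereal K}" by auto
      qed
      finally show ?case .
    qed
  qed
qed

end
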